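(* Let $G$ be a Polish group and let $H$ be a closed subgroup of $G$ that is cocompact. Then $H$, equipped with its intrinsic coarse structure $\mathcal{E}_{\mathcal{P}(H)}$, is coarsely equivalent to $G$ (equipped with $\mathcal{E}_{\mathcal{P}(G)}$). In particular, the inclusion map $\iota\colon H\hookrightarrow G$ is a coarse equivalence.
   Context: A pseudometric $d$ is a symmetric, non-negative real-valued function satisfying the triangle inequality and $d(x,x)=0$. For a topological group $\Gamma$, $\mathcal{P}(\Gamma)$ is the family of all continuous left-invariant pseudometrics on $\Gamma$, and $\mathcal{E}_{\mathcal{P}(\Gamma)}=\{E\subseteq \Gamma\times \Gamma\mid \forall d\in\mathcal{P}(\Gamma),\ \sup_{(x,y)\in E}d(x,y)<\infty\}$ is its (left-)coarse structure; its elements are called entourages. The group $H$ carries the subspace topology from $G$. A closed subgroup $H$ of $G$ is cocompact if there is a compact subset $K\subseteq G$ with $G=HK$. For sets $X,Y$ with coarse structures $\mathcal{E}_X,\mathcal{E}_Y$: a subset $B$ is coarsely bounded if $B\times B$ is an entourage. A map $\phi\colon X\to Y$ is controlled if $(\phi\times\phi)(E)\in\mathcal{E}_Y$ for all $E\in\mathcal{E}_X$; coarsely proper if preimages of coarsely bounded sets are coarsely bounded; coarse if both. Maps $\phi_1,\phi_2\colon A\to Y$ are close if $\{(\phi_1(a),\phi_2(a))\mid a\in A\}\in\mathcal{E}_Y$. A coarse map $\phi\colon X\to Y$ is a coarse equivalence if there is a coarse map $\psi\colon Y\to X$ with $\phi\circ\psi$ close to $\mathrm{id}_Y$ and $\psi\circ\phi$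 close to $\mathrm{id}_X$; then $X$ and $Y$ are coarsely equivalent. *)

theory Defs
  imports "HOL-Analysis.Abstract_Metric_Spaces" "HOL-Algebra.Coset"
begin

section \<open>Topological groups\<close>

definition topological_group :: "('a, 'b) monoid_scheme \<Rightarrow> 'a topology \<Rightarrow> bool" where
  "topological_group G T \<longleftrightarrow>
     group G \<and> topspace T = carrier G \<and>
     continuous_map (prod_topology T T) T (\<lambda>(x, y). x \<otimes>\<^bsub>G\<^esub> y) \<and>
     continuous_map T T (\<lambda>x. inv\<^bsub>G\<^esub> x)"

definition polish_group :: "('a, 'b) monoid_scheme \<Rightarrow> 'a topology \<Rightarrow> bool" where
  "polish_group G T \<longleftrightarrow>
     topological_group G T \<and> separable_space T \<and> completely_metrizable_space T"

definition cocompact :: "('a, 'b) monoid_scheme \<Rightarrow> 'a topology \<Rightarrow> 'a set \<Rightarrow> bool" where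
  "cocompact G T H \<longleftrightarrow> (\<exists>K. compactin T K \<and> carrier G = H <#>\<^bsub>G\<^esub> K)"


section \<open>The left-coarse structure of a topological group\<close>

definition pseudometric_on :: "'a set \<Rightarrow> ('a \<Rightarrow> 'a \<Rightarrow> real) \<Rightarrow> bool" where
  "pseudometric_on X d \<longleftrightarrow>
     (\<forall>x\<in>X. \<forall>y\<in>X. 0 \<le> d x y) \<and>
     (\<forall>x\<in>X. d x x = 0) \<and>
     (\<forall>x\<in>X. \<forall>y\<in>X. d x y = d y x) \<and>
     (\<forall>x\<in>X. \<forall>y\<in>X. \<forall>z\<in>X. d x z \<le> d x y + d y z)"

definition cont_left_inv_pseudometrics ::
    "('a, 'b) monoid_scheme \<Rightarrow> 'a topology \<Rightarrow> ('a \<Rightarrow> 'a \<Rightarrow> real) set" where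
  "cont_left_inv_pseudometrics G T =
     {d. pseudometric_on (carrier G) d \<and>
         continuous_map (prod_topology T T) euclideanreal (\<lambda>(x, y). d x y) \<and>
         (\<forall>g\<in>carrier G. \<forall>x\<in>carrier G. \<forall>y\<in>carrier G.
            d (g \<otimes>\<^bsub>G\<^esub> x) (g \<otimes>\<^bsub>G\<^esub> y) = d x y)}"

text \<open>The finiteness of the supremum is expressed by boundedness above, since the supremum of
  an unbounded set of reals is unspecified.\<close>

definition left_entourages ::
    "('a, 'b) monoid_scheme \<Rightarrow> 'a topology \<Rightarrow> ('a \<times> 'a) set set" where
  "left_entourages G T =
     {E. E \<subseteq> carrier G \<times> carrier G \<and>
         (\<forall>d\<in>cont_left_inv_pseudometrics G T. bdd_above ((\<lambda>(x, y). d x y) ` E))}"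


section \<open>Coarse maps and coarse equivalences\<close>

text \<open>A coarse space is given by its carrier \<open>X\<close> and its family of entourages \<open>\<E>\<^sub>X\<close>.\<close>

definition coarsely_bounded :: "'a set \<Rightarrow> ('a \<times> 'a) set set \<Rightarrow> 'a set \<Rightarrow> bool" where
  "coarsely_bounded X \<E>\<^sub>X B \<longleftrightarrow> B \<subseteq> X \<and> B \<times> B \<in> \<E>\<^sub>X"

definition controlled ::
    "('a \<times> 'a) set set \<Rightarrow> ('b \<times> 'b) set set \<Rightarrow> ('a \<Rightarrow> 'b) \<Rightarrow> bool" where
  "controlled \<E>\<^sub>X \<E>\<^sub>Y \<phi> \<longleftrightarrow> (\<forall>E\<in>\<E>\<^sub>X. map_prod \<phi> \<phi> ` E \<in> \<E>\<^sub>Y)"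

definition coarsely_proper ::
    "'a set \<Rightarrow> ('a \<times> 'a) set set \<Rightarrow> 'b set \<Rightarrow> ('b \<times> 'b) set set \<Rightarrow> ('a \<Rightarrow> 'b) \<Rightarrow> bool" where
  "coarsely_proper X \<E>\<^sub>X Y \<E>\<^sub>Y \<phi> \<longleftrightarrow>
     (\<forall>B. coarsely_bounded Y \<E>\<^sub>Y B \<longrightarrow> coarsely_bounded X \<E>\<^sub>X {x\<in>X. \<phi> x \<in> B})"

definition coarse_map ::
    "'a set \<Rightarrow> ('a \<times> 'a) set set \<Rightarrow> 'b set \<Rightarrow> ('b \<times> 'b) set set \<Rightarrow> ('a \<Rightarrow> 'b) \<Rightarrow> bool" where
  "coarse_map X \<E>\<^sub>X Y \<E>\<^sub>Y \<phi> \<longleftrightarrow>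
     \<phi> \<in> X \<rightarrow> Y \<and> controlled \<E>\<^sub>X \<E>\<^sub>Y \<phi> \<and> coarsely_proper X \<E>\<^sub>X Y \<E>\<^sub>Y \<phi>"

definition close_maps ::
    "'a set \<Rightarrow> ('b \<times> 'b) set set \<Rightarrow> ('a \<Rightarrow> 'b) \<Rightarrow> ('a \<Rightarrow> 'b) \<Rightarrow> bool" where
  "close_maps A \<E>\<^sub>Y \<phi>1 \<phi>2 \<longleftrightarrow> (\<lambda>a. (\<phi>1 a, \<phi>2 a)) ` A \<in> \<E>\<^sub>Y"

definition coarse_equivalence ::
    "'a set \<Rightarrow> ('a \<times> 'a) set set \<Rightarrow> 'b set \<Rightarrow> ('b \<times> 'b) set set \<Rightarrow> ('a \<Rightarrow> 'b) \<Rightarrow> bool" where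
  "coarse_equivalence X \<E>\<^sub>X Y \<E>\<^sub>Y \<phi> \<longleftrightarrow>
     coarse_map X \<E>\<^sub>X Y \<E>\<^sub>Y \<phi> \<and>
     (\<exists>\<psi>. coarse_map Y \<E>\<^sub>Y X \<E>\<^sub>X \<psi> \<and>
          close_maps Y \<E>\<^sub>Y (\<phi> \<circ> \<psi>) id \<and> close_maps X \<E>\<^sub>X (\<psi> \<circ> \<phi>) id)"

definition coarsely_equivalent ::
    "'a set \<Rightarrow> ('a \<times> 'a) set set \<Rightarrow> 'b set \<Rightarrow> ('b \<times> 'b) set set \<Rightarrow> bool" where
  "coarsely_equivalent X \<E>\<^sub>X Y \<E>\<^sub>Y \<longleftrightarrow> (\<exists>\<phi>. coarse_equivalence X \<E>\<^sub>X Y \<E>\<^sub>Y \<phi>)"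

end

theory Submission
  imports Defs
begin

text \<open>
  The two directions of the equivalence are of very different depth. Every continuous left-invariant
  pseudometric on \<open>G\<close> restricts to one on \<open>H\<close>, and since \<open>G = HK\<close> with \<open>K\<close> compact, each element of
  \<open>G\<close> is uniformly close to an element of \<open>H\<close> for each such pseudometric. So everything reduces to
  one claim (\<open>left_entourages_cocompact_subgroup\<close>): a subset of \<open>H \<times> H\<close> that is bounded for all
  pseudometrics of \<open>G\<close> is bounded for all pseudometrics \<open>d\<close> of \<open>H\<close>.

  For this it suffices that \<open>d\<close> is dominated on \<open>H\<close>, at large scale, by a continuous left-invariant
  pseudometric \<open>D\<close> of \<open>G\<close> (\<open>dominating_pseudometric\<close>). A substitute that may be discontinuous is easy to find:
  measure \<open>g\<close> by the supremum of \<open>d 1 h\<close> over all \<open>h \<in> H\<close> for which \<open>k g = h k'\<close> has a solution with \<open>k\<close> and \<open>k'\<close> in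
  \<open>K\<close>. This size is symmetric and, because \<open>G = HK\<close>, subadditive (\<open>drift_le_mult\<close>); it is locally
  bounded because the elements \<open>h\<close> range over the intersection of the compact set \<open>K g K\<^bsup>-1\<^esup>\<close> with the
  closed subgroup \<open>H\<close> (\<open>drift_locally_bounded\<close>); and on \<open>H\<close> it is at least \<open>d 1 h\<close> up to an additive
  constant (\<open>len_le_drift\<close>).

  To replace this size by a continuous pseudometric, take its sublevel sets with bounds growing like
  \<open>3\<^sup>n\<close> as the large levels, and shrinking neighbourhoods of the identity as the small levels, of a
  filtration of \<open>G\<close> indexed by the integers in which products of three elements move up by one level.
  The Birkhoff--Kakutani construction, in Frink's form for chains, turns such a filtration into a
  left-invariant pseudometric that is comparable to \<open>2\<^sup>j\<close> at level \<open>j\<close>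
  (\<open>filtration_pseudometric\<close>). The small levels make it continuous, the large ones make it dominate
  the size, and hence \<open>d\<close>.
\<close>

section \<open>Pseudometrics from weighted chains\<close>

text \<open>Frink's metrization argument: a symmetric weight for which three consecutive steps at most double
  the maximal weight is, up to a factor of two, the pseudometric obtained by minimising the total
  weight of finite chains.\<close>

definition chain_sums :: "'a set \<Rightarrow> ('a \<Rightarrow> 'a \<Rightarrow> real) \<Rightarrow> 'a \<Rightarrow> 'a \<Rightarrow> real set" where
  "chain_sums X f x y =
     {s. \<exists>n c. c 0 = x \<and> c n = y \<and> range c \<subseteq> X \<and> s = (\<Sum>i<n. f (c i) (c (Suc i)))}"

definition chain_dist :: "'a set \<Rightarrow> ('a \<Rightarrow> 'a \<Rightarrow> real) \<Rightarrow> 'a \<Rightarrow> 'a \<Rightarrow> real" where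
  "chain_dist X f x y = Inf (chain_sums X f x y)"

locale quasimetric =
  fixes X :: "'a set" and f :: "'a \<Rightarrow> 'a \<Rightarrow> real"
  assumes nonneg: "\<lbrakk>x \<in> X; y \<in> X\<rbrakk> \<Longrightarrow> 0 \<le> f x y"
    and diagonal: "x \<in> X \<Longrightarrow> f x x = 0"
    and symmetric: "\<lbrakk>x \<in> X; y \<in> X\<rbrakk> \<Longrightarrow> f x y = f y x"
    and weak_triangle: "\<lbrakk>x \<in> X; y \<in> X; z \<in> X; w \<in> X; f x y \<le> s; f y z \<le> s; f z w \<le> s\<rbrakk>
      \<Longrightarrow> f x w \<le> 2 * s"
begin

text \<open>Cut the chain at the last index at which the initial part still carries at most half of the
  total weight \<open>S\<close>. Then one edge and a final part, again of weight at most \<open>S / 2\<close>, remain. By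
  induction the ends of the initial part, and those of the final part, are within \<open>S\<close>; so is the
  edge between them, and the weak triangle inequality gives \<open>2 * S\<close>.\<close>

lemma end_to_end_le_twice_chain:
  assumes "m \<le> n" "range c \<subseteq> X"
  shows "f (c m) (c n) \<le> 2 * (\<Sum>i=m..<n. f (c i) (c (Suc i)))"
  using assms(1)
proof (induction "n - m" arbitrary: m n rule: less_induct)
  case less
  let ?S = "\<lambda>m n. \<Sum>i=m..<n. f (c i) (c (Suc i))"
  have c: "c i \<in> X" for i using assms(2) by auto
  have S0: "0 \<le> ?S a b" for a b by (intro sum_nonneg nonneg c)
  show ?case
  proof (cases "m = n")
    case True
    then show ?thesis using diagonal c by simp
  next
    case False
    let ?s = "?S m n"
    define A where "A = {k. m \<le> k \<and> k < n \<and> ?S m k \<le> ?s / 2}"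
    have "m \<in> A" "finite A" using False less.prems S0[of m n] by (auto simp: A_def)
    define k where "k = Max A"
    have "k \<in> A" using \<open>m \<in> A\<close> \<open>finite A\<close> unfolding k_def by (intro Max_in) auto
    then have k: "m \<le> k" "k < n" "?S m k \<le> ?s / 2" by (auto simp: A_def)
    have split1: "?s = ?S m k + ?S k n"
      using k by (simp add: sum.atLeastLessThan_concat)
    have split2: "?S k n = f (c k) (c (Suc k)) + ?S (Suc k) n"
      using k by (simp add: sum.atLeast_Suc_lessThan)
    \<comment> \<open>maximality of \<open>k\<close>: past the edge that leaves \<open>k\<close>, at most half of the sum remains\<close>
    have tail: "?S (Suc k) n \<le> ?s / 2"
    proof (cases "Suc k < n")
      case True
      have "Suc k \<notin> A" using Max_ge[OF \<open>finite A\<close>, of "Suc k"] unfolding k_def by linarith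
      then have "?S m (Suc k) > ?s / 2" using True k by (auto simp: A_def)
      moreover have "?s = ?S m (Suc k) + ?S (Suc k) n"
        using k by (simp add: sum.atLeastLessThan_concat del: sum.op_ivl_Suc)
      ultimately show ?thesis by simp
    next
      case False
      then show ?thesis using S0[of m n] by simp
    qed
    have "f (c m) (c k) \<le> 2 * ?S m k" using less.hyps[of k m] k by simp
    then have 1: "f (c m) (c k) \<le> ?s" using k by simp
    have "f (c (Suc k)) (c n) \<le> 2 * ?S (Suc k) n" using less.hyps[of n "Suc k"] k by simp
    then have 3: "f (c (Suc k)) (c n) \<le> ?s" using tail by simp
    have 2: "f (c k) (c (Suc k)) \<le> ?s"
      using split1 split2 S0[of m k] S0[of "Suc k" n] by simp
    show ?thesis by (rule weak_triangle[OF c c c c 1 2 3])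
  qed
qed

lemma chain_sums_ge:
  assumes "s \<in> chain_sums X f x y" shows "0 \<le> s" "f x y \<le> 2 * s"
proof -
  obtain n c where c: "c 0 = x" "c n = y" "range c \<subseteq> X" "s = (\<Sum>i<n. f (c i) (c (Suc i)))"
    using assms unfolding chain_sums_def by blast
  show "0 \<le> s" unfolding c(4) using c(3) by (intro sum_nonneg nonneg) auto
  show "f x y \<le> 2 * s"
    using end_to_end_le_twice_chain[of 0 n c] c by (simp add: atLeast0LessThan)
qed

lemma one_step_in_chain_sums:
  assumes "x \<in> X" "y \<in> X" shows "f x y \<in> chain_sums X f x y"
  unfolding chain_sums_def using assms
  by (intro CollectI exI[of _ 1] exI[of _ "\<lambda>i. if i = 0 then x else y"]) auto

lemma chain_dist_le:
  assumes "s \<in> chain_sums X f x y" shows "chain_dist X f x y \<le> s"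
  unfolding chain_dist_def using chain_sums_ge(1)
  by (intro cInf_lower assms bdd_belowI[of _ 0]) auto

lemma chain_dist_le_weight: "\<lbrakk>x \<in> X; y \<in> X\<rbrakk> \<Longrightarrow> chain_dist X f x y \<le> f x y"
  by (intro chain_dist_le one_step_in_chain_sums)

lemma le_chain_distI:
  assumes "x \<in> X" "y \<in> X" "\<And>s. s \<in> chain_sums X f x y \<Longrightarrow> r \<le> s"
  shows "r \<le> chain_dist X f x y"
  unfolding chain_dist_def using one_step_in_chain_sums assms by (intro cInf_greatest) auto

lemma weight_le_twice_chain_dist:
  assumes "x \<in> X" "y \<in> X" shows "f x y \<le> 2 * chain_dist X f x y"
  using le_chain_distI[OF assms, of "f x y / 2"] chain_sums_ge(2) by fastforce

lemma chain_sums_sym: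
  assumes "s \<in> chain_sums X f x y" shows "s \<in> chain_sums X f y x"
proof -
  obtain n c where c: "c 0 = x" "c n = y" "range c \<subseteq> X" "s = (\<Sum>i<n. f (c i) (c (Suc i)))"
    using assms unfolding chain_sums_def by blast
  have "(\<Sum>i<n. f (c (n - i)) (c (n - Suc i))) = (\<Sum>i<n. f (c (n - Suc i)) (c (Suc (n - Suc i))))"
    using c(3) by (intro sum.cong) (auto simp: Suc_diff_Suc intro!: symmetric)
  also have "\<dots> = s" unfolding c(4)
    by (rule sum.nat_diff_reindex[where g = "\<lambda>i. f (c i) (c (Suc i))"])
  finally show ?thesis unfolding chain_sums_def using c
    by (intro CollectI exI[of _ n] exI[of _ "\<lambda>i. c (n - i)"]) auto
qed

lemma chain_sums_concat:
  assumes "s \<in> chain_sums X f x y" "t \<in> chain_sums X f y z"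
  shows "s + t \<in> chain_sums X f x z"
proof -
  obtain n c where c: "c 0 = x" "c n = y" "range c \<subseteq> X" "s = (\<Sum>i<n. f (c i) (c (Suc i)))"
    using assms unfolding chain_sums_def by blast
  obtain m b where b: "b 0 = y" "b m = z" "range b \<subseteq> X" "t = (\<Sum>i<m. f (b i) (b (Suc i)))"
    using assms unfolding chain_sums_def by blast
  define e where "e i = (if i \<le> n then c i else b (i - n))" for i
  have e: "e (i + n) = b i" for i using c b by (auto simp: e_def)
  have "(\<Sum>i<n+m. f (e i) (e (Suc i))) =
      (\<Sum>i=0..<n. f (e i) (e (Suc i))) + (\<Sum>i=n..<n+m. f (e i) (e (Suc i)))"
    by (simp only: sum.atLeastLessThan_concat le0 le_add1 flip: atLeast0LessThan)
  also have "(\<Sum>i=n..<n+m. f (e i) (e (Suc i))) = (\<Sum>i=0..<m. f (e (i + n)) (e (Suc i + n)))"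
    using sum.shift_bounds_nat_ivl[of "\<lambda>i. f (e i) (e (Suc i))" 0 n m] by (simp add: add.commute)
  also have "\<dots> = t" unfolding b(4) e by (simp add: atLeast0LessThan)
  also have "(\<Sum>i=0..<n. f (e i) (e (Suc i))) = s"
    unfolding c(4) by (intro sum.cong) (auto simp: e_def)
  finally have "s + t = (\<Sum>i<n+m. f (e i) (e (Suc i)))" by simp
  moreover have "e 0 = x" "e (n + m) = z" "range e \<subseteq> X"
    using c b e[of m] by (auto simp: e_def add.commute)
  ultimately show ?thesis unfolding chain_sums_def by blast
qed

lemma pseudometric_chain_dist: "pseudometric_on X (chain_dist X f)"
  unfolding pseudometric_on_def
proof (intro conjI ballI)
  fix x y z assume xyz: "x \<in> X" "y \<in> X" "z \<in> X"
  show "0 \<le> chain_dist X f x y" using xyz chain_sums_ge(1) by (intro le_chain_distI) auto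
  show "chain_dist X f x y = chain_dist X f y x"
    unfolding chain_dist_def using chain_sums_sym by (metis subsetI subset_antisym)
  have "chain_dist X f x z - s \<le> chain_dist X f y z" if s: "s \<in> chain_sums X f x y" for s
  proof (rule le_chain_distI)
    fix t assume "t \<in> chain_sums X f y z"
    then show "chain_dist X f x z - s \<le> t" using chain_dist_le[OF chain_sums_concat[OF s]] by fastforce
  qed (use xyz in auto)
  then have "chain_dist X f x z - chain_dist X f y z \<le> chain_dist X f x y"
    using xyz by (intro le_chain_distI) (auto simp: algebra_simps)
  then show "chain_dist X f x z \<le> chain_dist X f x y + chain_dist X f y z" by simp
next
  fix x assume "x \<in> X"
  then have "chain_dist X f x x \<le> 0" "0 \<le> 2 * chain_dist X f x x"
    using chain_dist_le_weight[of x x] weight_le_twice_chain_dist[of x x] diagonal by auto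
  then show "chain_dist X f x x = 0" by simp
qed

end

section \<open>Left-invariant pseudometrics from filtrations of a group\<close>

lemma (in group) inv_mult_cancel:
  assumes "x \<in> carrier G" "y \<in> carrier G"
  shows "inv x \<otimes> (x \<otimes> y) = y" "x \<otimes> (inv x \<otimes> y) = y"
  using assms by (simp_all flip: m_assoc)

text \<open>A group exhausted by sets indexed by all integers, with three factors moving up one level, has
  both a small scale (negative indices, later chosen as neighbourhoods of the identity) and a large
  scale (positive indices). Giving level \<open>j\<close> the size \<open>2\<^sup>j\<close> makes the shift by one level the
  factor two of the weak triangle inequality, so one pseudometric sees both scales.\<close>

locale filtered_group = group G for G (structure) +
  fixes V :: "int \<Rightarrow> 'a set"
  assumes filter_subset: "V j \<subseteq> carrier G"
    and one_filter: "\<one> \<in> V j"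
    and inv_filter: "x \<in> V j \<Longrightarrow> inv x \<in> V j"
    and mult_filter: "\<lbrakk>x \<in> V j; y \<in> V j; z \<in> V j\<rbrakk> \<Longrightarrow> x \<otimes> y \<otimes> z \<in> V (j + 1)"
    and filter_exhausts: "x \<in> carrier G \<Longrightarrow> \<exists>j. x \<in> V j"
begin

lemma filter_mono: assumes "i \<le> j" shows "V i \<subseteq> V j"
  using assms
proof (induction j rule: int_ge_induct)
  case (step j)
  have "V j \<subseteq> V (j + 1)"
    using mult_filter[OF _ one_filter one_filter] filter_subset by fastforce
  then show ?case using step by blast
qed simp

definition dyadic_length :: "'a \<Rightarrow> real" where
  "dyadic_length g = Inf ((\<lambda>j. 2 powi j) ` {j. g \<in> V j})"

lemma dyadic_length_le: "g \<in> V j \<Longrightarrow> dyadic_length g \<le> 2 powi j"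
  unfolding dyadic_length_def by (intro cInf_lower bdd_belowI2[of _ 0]) auto

lemma dyadic_length_nonneg: "g \<in> carrier G \<Longrightarrow> 0 \<le> dyadic_length g"
  unfolding dyadic_length_def using filter_exhausts by (intro cInf_greatest) auto

lemma mem_filter_if_dyadic_length_less:
  assumes "g \<in> carrier G" "dyadic_length g < 2 powi (j + 1)" shows "g \<in> V j"
proof -
  have "(\<lambda>j. 2 powi j :: real) ` {j. g \<in> V j} \<noteq> {}" using filter_exhausts assms(1) by auto
  from cInf_lessD[OF this assms(2)[unfolded dyadic_length_def]]
  obtain i where "g \<in> V i" "(2::real) powi i < 2 powi (j + 1)" by auto
  then have "i \<le> j" by (smt (verit) power_int_increasing)
  then show ?thesis using \<open>g \<in> V i\<close> filter_mono by blast
qed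

lemma between_powers_of_two:
  assumes "(0::real) < e" obtains j where "2 powi j \<le> e" "e < 2 powi (j + 1)"
proof
  let ?j = "\<lfloor>log 2 e\<rfloor>"
  have "2 powr real_of_int ?j \<le> 2 powr log 2 e" by (intro powr_mono) auto
  then show "2 powi ?j \<le> e" using assms by (simp add: powr_real_of_int')
  have "2 powr log 2 e < 2 powr real_of_int (?j + 1)" by (intro powr_less_mono) linarith+
  then have "e < 2 powr real_of_int (?j + 1)" using assms by simp
  also have "\<dots> = 2 powi (?j + 1)" by (rule powr_real_of_int') auto
  finally show "e < 2 powi (?j + 1)" .
qed

text \<open>Every \<open>r > 2 * s\<close> lies between two consecutive doubled powers of two. This places the three
  factors in a common level whose successor has size at most \<open>r\<close>.\<close>

lemma dyadic_length_mult:
  assumes "a \<in> carrier G" "b \<in> carrier G" "c \<in> carrier G"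
    and "dyadic_length a \<le> s" "dyadic_length b \<le> s" "dyadic_length c \<le> s"
  shows "dyadic_length (a \<otimes> b \<otimes> c) \<le> 2 * s"
proof (rule dense_ge)
  fix r assume "2 * s < r"
  moreover have "0 \<le> s" using dyadic_length_nonneg[OF assms(1)] assms(4) by simp
  ultimately have "0 < r / 2" "s < r / 2" by auto
  then obtain j where j: "2 powi j \<le> r / 2" "r / 2 < 2 powi (j + 1)"
    using between_powers_of_two by metis
  have "a \<in> V j" "b \<in> V j" "c \<in> V j"
    using j \<open>s < r / 2\<close> assms by (auto intro!: mem_filter_if_dyadic_length_less)
  then have "dyadic_length (a \<otimes> b \<otimes> c) \<le> 2 powi (j + 1)"
    by (intro dyadic_length_le mult_filter)
  also have "\<dots> = 2 * 2 powi j" by (simp add: power_int_add)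
  finally show "dyadic_length (a \<otimes> b \<otimes> c) \<le> r" using j by simp
qed

definition dyadic_weight :: "'a \<Rightarrow> 'a \<Rightarrow> real" where
  "dyadic_weight x y = dyadic_length (inv x \<otimes> y)"

definition dyadic_dist :: "'a \<Rightarrow> 'a \<Rightarrow> real" where
  "dyadic_dist = chain_dist (carrier G) dyadic_weight"

lemma dyadic_length_inv: "g \<in> carrier G \<Longrightarrow> dyadic_length (inv g) = dyadic_length g"
proof -
  assume g: "g \<in> carrier G"
  have "{j. inv g \<in> V j} = {j. g \<in> V j}" using inv_filter[of "inv g"] inv_filter[of g] g by auto
  then show ?thesis by (simp add: dyadic_length_def)
qed

sublocale quasimetric "carrier G" dyadic_weight
proof
  fix x y z w s
  assume x: "x \<in> carrier G" 
  show "dyadic_weight x x = 0"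
  proof -
    have "dyadic_length \<one> \<le> e" if "0 < e" for e
      using between_powers_of_two[OF that] dyadic_length_le[OF one_filter] order_trans by metis
    then have "dyadic_length \<one> \<le> 0" by (meson dense_ge)
    then show ?thesis using dyadic_length_nonneg[of \<one>] x by (simp add: dyadic_weight_def)
  qed
  assume y: "y \<in> carrier G"
  show "0 \<le> dyadic_weight x y" using x y by (simp add: dyadic_weight_def dyadic_length_nonneg)
  show "dyadic_weight x y = dyadic_weight y x"
    using dyadic_length_inv[of "inv x \<otimes> y"] x y by (simp add: dyadic_weight_def inv_mult_group)
  assume zw: "z \<in> carrier G" "w \<in> carrier G"
    and s: "dyadic_weight x y \<le> s" "dyadic_weight y z \<le> s" "dyadic_weight z w \<le> s"
  have "inv x \<otimes> w = (inv x \<otimes> y) \<otimes> (inv y \<otimes> z) \<otimes> (inv z \<otimes> w)"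
    using x y zw by (simp add: m_assoc inv_mult_cancel)
  then show "dyadic_weight x w \<le> 2 * s"
    using dyadic_length_mult s x y zw unfolding dyadic_weight_def by simp
qed

lemma dyadic_dist_le:
  assumes "x \<in> carrier G" "y \<in> carrier G" "inv x \<otimes> y \<in> V j"
  shows "dyadic_dist x y \<le> 2 powi j"
  using chain_dist_le_weight[OF assms(1,2)] dyadic_length_le[OF assms(3)]
  by (simp add: dyadic_dist_def dyadic_weight_def)

lemma mem_filter_if_dyadic_dist_less:
  assumes "x \<in> carrier G" "y \<in> carrier G" "dyadic_dist x y < 2 powi j"
  shows "inv x \<otimes> y \<in> V j"
proof (rule mem_filter_if_dyadic_length_less)
  have "dyadic_length (inv x \<otimes> y) \<le> 2 * dyadic_dist x y"
    using weight_le_twice_chain_dist[OF assms(1,2)] by (simp add: dyadic_dist_def dyadic_weight_def)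
  also have "\<dots> < 2 powi (j + 1)" using assms(3) by (simp add: power_int_add)
  finally show "dyadic_length (inv x \<otimes> y) < 2 powi (j + 1)" .
qed (use assms in auto)

lemma pseudometric_dyadic_dist: "pseudometric_on (carrier G) dyadic_dist"
  unfolding dyadic_dist_def by (rule pseudometric_chain_dist)

lemma chain_sums_translate:
  assumes g: "g \<in> carrier G" and s: "s \<in> chain_sums (carrier G) dyadic_weight x y"
  shows "s \<in> chain_sums (carrier G) dyadic_weight (g \<otimes> x) (g \<otimes> y)"
proof -
  obtain n c where c: "c 0 = x" "c n = y" "range c \<subseteq> carrier G"
      "s = (\<Sum>i<n. dyadic_weight (c i) (c (Suc i)))"
    using s unfolding chain_sums_def by blast
  have "inv (g \<otimes> u) \<otimes> (g \<otimes> v) = inv u \<otimes> v" if "u \<in> carrier G" "v \<in> carrier G" for u v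
    using that g by (simp add: inv_mult_group m_assoc inv_mult_cancel)
  then have "s = (\<Sum>i<n. dyadic_weight (g \<otimes> c i) (g \<otimes> c (Suc i)))"
    unfolding c(4) dyadic_weight_def using c(3)
    by (intro sum.cong) (auto simp: image_subset_iff)
  then show ?thesis unfolding chain_sums_def using c g
    by (intro CollectI exI[of _ n] exI[of _ "\<lambda>i. g \<otimes> c i"]) auto
qed

lemma dyadic_dist_left_invariant:
  assumes g: "g \<in> carrier G" and "x \<in> carrier G" "y \<in> carrier G"
  shows "dyadic_dist (g \<otimes> x) (g \<otimes> y) = dyadic_dist x y"
proof -
  have "chain_sums (carrier G) dyadic_weight (g \<otimes> x) (g \<otimes> y)
      = chain_sums (carrier G) dyadic_weight x y"
    using chain_sums_translate[OF g, of _ x y]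
      chain_sums_translate[of "inv g" _ "g \<otimes> x" "g \<otimes> y"] assms
    by (fastforce simp: inv_mult_cancel)
  then show ?thesis by (simp add: dyadic_dist_def chain_dist_def)
qed

end

section \<open>Continuity of left-invariant pseudometrics\<close>

text \<open>Translation carries smallness at the identity to every point, and the triangle inequality carries
  continuity in each variable to joint continuity.\<close>

lemma cont_left_inv_pseudometricI:
  assumes G: "topological_group G T" and d: "pseudometric_on (carrier G) d"
    and inv: "\<And>g x y. \<lbrakk>g \<in> carrier G; x \<in> carrier G; y \<in> carrier G\<rbrakk>
      \<Longrightarrow> d (g \<otimes>\<^bsub>G\<^esub> x) (g \<otimes>\<^bsub>G\<^esub> y) = d x y"
    and small: "\<And>e. 0 < e \<Longrightarrow> \<exists>U. openin T U \<and> \<one>\<^bsub>G\<^esub> \<in> U \<and> (\<forall>u\<in>U. d \<one>\<^bsub>G\<^esub> u < e)"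
  shows "d \<in> cont_left_inv_pseudometrics G T"
proof -
  interpret group G using G by (simp add: topological_group_def)
  have top: "topspace T = carrier G" using G by (simp add: topological_group_def)
  have mult: "continuous_map (prod_topology T T) T (\<lambda>(x, y). x \<otimes>\<^bsub>G\<^esub> y)"
    using G by (simp add: topological_group_def)
  have sym: "d x y = d y x" and tri: "d x z \<le> d x y + d y z"
    if "x \<in> carrier G" "y \<in> carrier G" "z \<in> carrier G" for x y z
    using d that by (auto simp: pseudometric_on_def)
  have ball: "\<exists>U. openin T U \<and> x \<in> U \<and> (\<forall>u\<in>U. d x u < e)" if x: "x \<in> carrier G" and e: "0 < e" for x e
  proof -
    obtain U where U: "openin T U" "\<one>\<^bsub>G\<^esub> \<in> U" "\<forall>u\<in>U. d \<one>\<^bsub>G\<^esub> u < e" using small[OF e] by blast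
    have "continuous_map T (prod_topology T T) (\<lambda>y. (inv\<^bsub>G\<^esub> x, y))"
      using x by (simp add: continuous_map_pairwise o_def top)
    from continuous_map_compose[OF this mult]
    have "continuous_map T T (\<lambda>y. inv\<^bsub>G\<^esub> x \<otimes>\<^bsub>G\<^esub> y)" by (simp add: o_def)
    then have "openin T {y \<in> topspace T. inv\<^bsub>G\<^esub> x \<otimes>\<^bsub>G\<^esub> y \<in> U}"
      using U(1) by (rule openin_continuous_map_preimage)
    \<comment> \<open>the ball around \<open>x\<close> is the translate of the ball around the identity\<close>
    moreover have "d x y = d \<one>\<^bsub>G\<^esub> (inv\<^bsub>G\<^esub> x \<otimes>\<^bsub>G\<^esub> y)" if "y \<in> carrier G" for y
      using inv[of "inv\<^bsub>G\<^esub> x" x y] x that by simp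
    ultimately show ?thesis using U x top
      by (intro exI[of _ "{y \<in> topspace T. inv\<^bsub>G\<^esub> x \<otimes>\<^bsub>G\<^esub> y \<in> U}"]) auto
  qed
  have "continuous_map (prod_topology T T) euclideanreal (\<lambda>(x, y). d x y)"
    unfolding Met_TC.continuous_map_to_metric[unfolded mtopology_is_euclidean]
  proof (intro ballI allI impI)
    fix p and e :: real assume p: "p \<in> topspace (prod_topology T T)" and e: "0 < e"
    obtain x y where xy: "p = (x, y)" "x \<in> carrier G" "y \<in> carrier G" using p top by auto
    obtain U W where U: "openin T U" "x \<in> U" "\<forall>u\<in>U. d x u < e / 2"
      and W: "openin T W" "y \<in> W" "\<forall>w\<in>W. d y w < e / 2"
      using ball[OF xy(2), of "e / 2"] ball[OF xy(3), of "e / 2"] e by auto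
    have "\<bar>d x y - d u w\<bar> < e" if "u \<in> U" "w \<in> W" for u w
    proof -
      have uw: "u \<in> carrier G" "w \<in> carrier G" using U W that openin_subset top by fast+
      have "d x y \<le> d x u + d u y" "d u y \<le> d u w + d w y" "d w y = d y w"
          "d u w \<le> d u x + d x w" "d x w \<le> d x y + d y w" "d u x = d x u"
        using xy uw tri sym by blast+
      then show ?thesis using U(3) W(3) that by (smt (verit) field_sum_of_halves)
    qed
    then show "\<exists>U. openin (prod_topology T T) U \<and> p \<in> U
        \<and> (\<forall>q\<in>U. (case q of (x, y) \<Rightarrow> d x y) \<in> Met_TC.mball (case p of (x, y) \<Rightarrow> d x y) e)"
      using U W xy
      by (intro exI[of _ "U \<times> W"]) (auto simp: openin_prod_Times_iff dist_real_def)
  qed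
  then show ?thesis using d inv by (simp add: cont_left_inv_pseudometrics_def)
qed

lemma square_nbhd:
  assumes G: "topological_group G T" and O: "openin T U" "\<one>\<^bsub>G\<^esub> \<in> U"
  obtains W where "openin T W" "\<one>\<^bsub>G\<^esub> \<in> W"
    "\<And>x y. \<lbrakk>x \<in> W; y \<in> W\<rbrakk> \<Longrightarrow> x \<otimes>\<^bsub>G\<^esub> y \<in> U"
proof -
  interpret group G using G by (simp add: topological_group_def)
  have top: "topspace T = carrier G"
    and mult: "continuous_map (prod_topology T T) T (\<lambda>(x, y). x \<otimes>\<^bsub>G\<^esub> y)"
    using G by (auto simp: topological_group_def)
  let ?P = "{p \<in> topspace (prod_topology T T). (case p of (x, y) \<Rightarrow> x \<otimes>\<^bsub>G\<^esub> y) \<in> U}"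
  have "openin (prod_topology T T) ?P" by (rule openin_continuous_map_preimage[OF mult O(1)])
  moreover have "(\<one>\<^bsub>G\<^esub>, \<one>\<^bsub>G\<^esub>) \<in> ?P" using O top by simp
  ultimately obtain A B where "openin T A" "openin T B" "\<one>\<^bsub>G\<^esub> \<in> A" "\<one>\<^bsub>G\<^esub> \<in> B" "A \<times> B \<subseteq> ?P"
    unfolding openin_prod_topology_alt by meson
  then show ?thesis by (intro that[of "A \<inter> B"]) auto
qed

lemma symmetric_cube_nbhd:
  assumes G: "topological_group G T" and O: "openin T U" "\<one>\<^bsub>G\<^esub> \<in> U"
  obtains W where "openin T W" "\<one>\<^bsub>G\<^esub> \<in> W" "\<And>x. x \<in> W \<Longrightarrow> inv\<^bsub>G\<^esub> x \<in> W"
    "\<And>x y z. \<lbrakk>x \<in> W; y \<in> W; z \<in> W\<rbrakk> \<Longrightarrow> x \<otimes>\<^bsub>G\<^esub> y \<otimes>\<^bsub>G\<^esub> z \<in> U"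
proof -
  interpret group G using G by (simp add: topological_group_def)
  have top: "topspace T = carrier G" and cinv: "continuous_map T T (\<lambda>x. inv\<^bsub>G\<^esub> x)"
    using G by (auto simp: topological_group_def)
  obtain A where A: "openin T A" "\<one>\<^bsub>G\<^esub> \<in> A" "\<And>x y. \<lbrakk>x \<in> A; y \<in> A\<rbrakk> \<Longrightarrow> x \<otimes>\<^bsub>G\<^esub> y \<in> U"
    using square_nbhd[OF G O] by blast
  obtain B where B: "openin T B" "\<one>\<^bsub>G\<^esub> \<in> B" "\<And>x y. \<lbrakk>x \<in> B; y \<in> B\<rbrakk> \<Longrightarrow> x \<otimes>\<^bsub>G\<^esub> y \<in> A"
    using square_nbhd[OF G A(1,2)] by blast
  have BG: "B \<subseteq> carrier G" using B(1) openin_subset top by fast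
  then have "B \<subseteq> A" using B(3)[OF _ B(2)] by fastforce
  let ?W = "B \<inter> {x \<in> topspace T. inv\<^bsub>G\<^esub> x \<in> B}"
  have "openin T ?W" using B(1) openin_continuous_map_preimage[OF cinv B(1)] by blast
  moreover have "\<one>\<^bsub>G\<^esub> \<in> ?W" using B(2) top by simp
  moreover have "inv\<^bsub>G\<^esub> x \<in> ?W" if "x \<in> ?W" for x using that BG top by auto
  moreover have "x \<otimes>\<^bsub>G\<^esub> y \<otimes>\<^bsub>G\<^esub> z \<in> U" if "x \<in> ?W" "y \<in> ?W" "z \<in> ?W" for x y z
  proof -
    have "x \<otimes>\<^bsub>G\<^esub> y \<in> A" "z \<in> A" using that B(3) \<open>B \<subseteq> A\<close> by auto
    then show ?thesis by (rule A(3))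
  qed
  ultimately show ?thesis by (rule that)
qed

text \<open>These sets serve as the negative levels of a filtration; the neighbourhood \<open>U\<close> prescribed at index
  zero is where they meet the nonnegative levels.\<close>

lemma descending_nbhds:
  assumes G: "topological_group G T" and O: "openin T U" "\<one>\<^bsub>G\<^esub> \<in> U"
  obtains W where "W 0 = U" "\<And>n::nat. openin T (W n)" "\<And>n. \<one>\<^bsub>G\<^esub> \<in> W n"
    "\<And>n x. x \<in> W (Suc n) \<Longrightarrow> inv\<^bsub>G\<^esub> x \<in> W (Suc n)"
    "\<And>n x y z. \<lbrakk>x \<in> W (Suc n); y \<in> W (Suc n); z \<in> W (Suc n)\<rbrakk> \<Longrightarrow> x \<otimes>\<^bsub>G\<^esub> y \<otimes>\<^bsub>G\<^esub> z \<in> W n"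
proof -
  let ?P = "\<lambda>n A. openin T A \<and> \<one>\<^bsub>G\<^esub> \<in> A \<and> (n = (0::nat) \<longrightarrow> A = U)"
  let ?Q = "\<lambda>A B. (\<forall>x\<in>B. inv\<^bsub>G\<^esub> x \<in> B) \<and> (\<forall>x\<in>B. \<forall>y\<in>B. \<forall>z\<in>B. x \<otimes>\<^bsub>G\<^esub> y \<otimes>\<^bsub>G\<^esub> z \<in> A)"
  have "\<exists>B. ?P (Suc n) B \<and> ?Q A B" if "?P n A" for n A
  proof -
    have A: "openin T A" "\<one>\<^bsub>G\<^esub> \<in> A" using that by auto
    show ?thesis by (rule symmetric_cube_nbhd[OF G A]) blast
  qed
  moreover have "\<exists>A. ?P 0 A" using O by blast
  ultimately have "\<exists>W. \<forall>n. ?P n (W n) \<and> ?Q (W n) (W (Suc n))"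
    by (intro dependent_nat_choice[of ?P "\<lambda>n. ?Q"])
  then obtain W where W: "\<forall>n. ?P n (W n) \<and> ?Q (W n) (W (Suc n))" by (rule exE)
  have P: "?P n (W n)" and Q: "?Q (W n) (W (Suc n))" for n using spec[OF W, of n] by simp_all
  show ?thesis
  proof (rule that[of W])
    show "W 0 = U" "openin T (W n)" "\<one>\<^bsub>G\<^esub> \<in> W n" for n using P by blast+
    show "inv\<^bsub>G\<^esub> x \<in> W (Suc n)" if "x \<in> W (Suc n)" for n x using Q that by blast
    show "x \<otimes>\<^bsub>G\<^esub> y \<otimes>\<^bsub>G\<^esub> z \<in> W n" if "x \<in> W (Suc n)" "y \<in> W (Suc n)" "z \<in> W (Suc n)" for n x y z
      using Q that by blast
  qed
qed

text \<open>The Birkhoff--Kakutani construction with a prescribed large scale. The given sets \<open>V n\<close> are the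
  levels \<open>n \<ge> 0\<close> of an integer-indexed filtration, and a descending sequence of neighbourhoods inside
  \<open>V 0\<close> supplies the negative levels. The latter make the dyadic pseudometric continuous, while the
  former keep it at least \<open>2\<^sup>n\<close> outside \<open>V n\<close>.\<close>

theorem filtration_pseudometric:
  assumes G: "topological_group G T"
    and V: "\<And>n::nat. V n \<subseteq> carrier G" "\<And>n. \<one>\<^bsub>G\<^esub> \<in> V n" "\<And>n x. x \<in> V n \<Longrightarrow> inv\<^bsub>G\<^esub> x \<in> V n"
      "\<And>n x y z. \<lbrakk>x \<in> V n; y \<in> V n; z \<in> V n\<rbrakk> \<Longrightarrow> x \<otimes>\<^bsub>G\<^esub> y \<otimes>\<^bsub>G\<^esub> z \<in> V (Suc n)"
      "\<And>x. x \<in> carrier G \<Longrightarrow> \<exists>n. x \<in> V n"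
    and U: "openin T U" "\<one>\<^bsub>G\<^esub> \<in> U" "U \<subseteq> V 0"
  obtains D where "D \<in> cont_left_inv_pseudometrics G T"
    "\<And>x y n. \<lbrakk>x \<in> carrier G; y \<in> carrier G; D x y < 2 ^ n\<rbrakk> \<Longrightarrow> inv\<^bsub>G\<^esub> x \<otimes>\<^bsub>G\<^esub> y \<in> V n"
proof -
  interpret group G using G by (simp add: topological_group_def)
  have top: "topspace T = carrier G" using G by (simp add: topological_group_def)
  obtain W where W: "W 0 = U" "\<And>n::nat. openin T (W n)" "\<And>n. \<one>\<^bsub>G\<^esub> \<in> W n"
    "\<And>n x. x \<in> W (Suc n) \<Longrightarrow> inv\<^bsub>G\<^esub> x \<in> W (Suc n)"
    "\<And>n x y z. \<lbrakk>x \<in> W (Suc n); y \<in> W (Suc n); z \<in> W (Suc n)\<rbrakk> \<Longrightarrow> x \<otimes>\<^bsub>G\<^esub> y \<otimes>\<^bsub>G\<^esub> z \<in> W n"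
    using descending_nbhds[OF G U(1,2)] by blast
  define F where "F j = (if 0 \<le> j then V (nat j) else W (nat (- j)))" for j :: int
  have Fneg: "F (- int (Suc n)) = W (Suc n)" for n by (simp add: F_def nat_add_distrib)
  have Fpos: "F (int n) = V n" for n by (simp add: F_def)
  have WG: "W n \<subseteq> carrier G" for n using openin_subset[OF W(2)] top by simp
  interpret filtered_group G F
  proof
    fix j
    show "F j \<subseteq> carrier G" using V(1) WG by (simp add: F_def)
    show "\<one>\<^bsub>G\<^esub> \<in> F j" using V(2) W(3) by (simp add: F_def)
    show "inv\<^bsub>G\<^esub> x \<in> F j" if "x \<in> F j" for x
    proof (cases j rule: int_cases)
      case (nonneg n)
      then show ?thesis using V(3) that by (simp only: Fpos)
    next
      case (neg n)
      then show ?thesis using W(4) that by (simp only: Fneg)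
    qed
    show "x \<otimes>\<^bsub>G\<^esub> y \<otimes>\<^bsub>G\<^esub> z \<in> F (j + 1)" if xyz: "x \<in> F j" "y \<in> F j" "z \<in> F j" for x y z
    proof (cases j rule: int_cases)
      case (nonneg n)
      have "j + 1 = int (Suc n)" using nonneg by simp
      moreover have "x \<otimes>\<^bsub>G\<^esub> y \<otimes>\<^bsub>G\<^esub> z \<in> V (Suc n)"
        using V(4) xyz unfolding nonneg Fpos by blast
      ultimately show ?thesis by (simp only: Fpos)
    next
      case (neg n)
      have *: "x \<otimes>\<^bsub>G\<^esub> y \<otimes>\<^bsub>G\<^esub> z \<in> W n" using W(5) xyz unfolding neg Fneg by blast
      show ?thesis
      proof (cases n)
        case 0
        then have "j + 1 = int 0" using neg by simp
        moreover have "x \<otimes>\<^bsub>G\<^esub> y \<otimes>\<^bsub>G\<^esub> z \<in> V 0" using * 0 W(1) U(3) by auto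
        ultimately show ?thesis by (simp only: Fpos)
      next
        case (Suc m)
        then have "j + 1 = - int (Suc m)" using neg by simp
        then show ?thesis using * Suc by (simp only: Fneg)
      qed
    qed
  next
    show "\<exists>j. x \<in> F j" if "x \<in> carrier G" for x using V(5)[OF that] Fpos by metis
  qed
  show ?thesis
  proof (rule that[of dyadic_dist])
    show "dyadic_dist \<in> cont_left_inv_pseudometrics G T"
    proof (rule cont_left_inv_pseudometricI[OF G pseudometric_dyadic_dist])
      show "dyadic_dist (g \<otimes>\<^bsub>G\<^esub> x) (g \<otimes>\<^bsub>G\<^esub> y) = dyadic_dist x y"
        if "g \<in> carrier G" "x \<in> carrier G" "y \<in> carrier G" for g x y
        using that by (rule dyadic_dist_left_invariant)
      fix e :: real assume "0 < e"
      then obtain n where n: "(1/2) ^ n < e" using real_arch_pow_inv[of e "1/2"] by auto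
      have "dyadic_dist \<one>\<^bsub>G\<^esub> u < e" if u: "u \<in> W (Suc n)" for u
      proof -
        have "u \<in> carrier G" using u WG by blast
        moreover have "u \<in> F (- int (Suc n))" using u by (simp only: Fneg)
        ultimately have "dyadic_dist \<one>\<^bsub>G\<^esub> u \<le> 2 powi (- int (Suc n))"
          by (intro dyadic_dist_le) auto
        also have "\<dots> \<le> 2 powi (- int n)" by (intro power_int_increasing) auto
        also have "\<dots> < e" using n by (simp add: power_int_minus power_one_over inverse_eq_divide)
        finally show ?thesis .
      qed
      then show "\<exists>U. openin T U \<and> \<one>\<^bsub>G\<^esub> \<in> U \<and> (\<forall>u\<in>U. dyadic_dist \<one>\<^bsub>G\<^esub> u < e)"
        using W(2,3) by blast
    qed
    show "inv\<^bsub>G\<^esub> x \<otimes>\<^bsub>G\<^esub> y \<in> V n"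
      if "x \<in> carrier G" "y \<in> carrier G" "dyadic_dist x y < 2 ^ n" for x y n
      using mem_filter_if_dyadic_dist_less[of x y "int n"] that by (simp add: Fpos)
  qed
qed

section \<open>Extending the large scale of a cocompact subgroup\<close>

text \<open>A continuous left-invariant pseudometric \<open>d\<close> on \<open>H\<close> is to be dominated on \<open>H\<close> by one
  that is defined on all of \<open>G = HK\<close>.\<close>

locale cocompact_pseudometric = group G for G (structure) +
  fixes T :: "'a topology" and H K :: "'a set" and d :: "'a \<Rightarrow> 'a \<Rightarrow> real"
  assumes top_group: "topological_group G T"
    and sub: "subgroup H G" and closed: "closedin T H"
    and compact: "compactin T K" and cover: "carrier G = H <#> K"
    and d: "d \<in> cont_left_inv_pseudometrics (G\<lparr>carrier := H\<rparr>) (subtopology T H)"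
begin

lemma topspace_eq: "topspace T = carrier G"
  using top_group by (simp add: topological_group_def)

lemma H_carrier: "h \<in> H \<Longrightarrow> h \<in> carrier G"
  using sub subgroup.subset by blast

lemma K_carrier: "k \<in> K \<Longrightarrow> k \<in> carrier G"
  using compactin_subset_topspace[OF compact] topspace_eq by blast

lemma decompose: assumes "g \<in> carrier G" obtains h k where "h \<in> H" "k \<in> K" "g = h \<otimes> k"
  using assms cover by (auto simp: set_mult_def)

definition len :: "'a \<Rightarrow> real" where "len h = d \<one> h"

lemma one_H: "\<one> \<in> H" and mult_H: "\<lbrakk>x \<in> H; y \<in> H\<rbrakk> \<Longrightarrow> x \<otimes> y \<in> H" and inv_H: "x \<in> H \<Longrightarrow> inv x \<in> H"
  using sub subgroup.one_closed subgroup.m_closed subgroup.m_inv_closed by metis+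

lemma d_facts:
  assumes "x \<in> H" "y \<in> H" "z \<in> H"
  shows "0 \<le> d x y" "d x x = 0" "d x y = d y x" "d x z \<le> d x y + d y z" "d (z \<otimes> x) (z \<otimes> y) = d x y"
  using d assms by (auto simp: cont_left_inv_pseudometrics_def pseudometric_on_def)

lemma d_eq_len: assumes "x \<in> H" "y \<in> H" shows "d x y = len (inv x \<otimes> y)"
  using d_facts(5)[of x y "inv x"] assms inv_H by (simp add: len_def H_carrier)

lemma len_mult: assumes "x \<in> H" "y \<in> H" shows "len (x \<otimes> y) \<le> len x + len y"
proof -
  have "len (x \<otimes> y) \<le> d \<one> x + d x (x \<otimes> y)"
    unfolding len_def using assms one_H mult_H by (intro d_facts(4)) auto
  moreover have "d x (x \<otimes> y) = len y"
    using assms one_H mult_H by (subst d_eq_len) (auto simp: H_carrier inv_mult_cancel)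
  ultimately show ?thesis by (simp add: len_def)
qed

lemma len_inv: assumes "x \<in> H" shows "len (inv x) = len x"
proof -
  have "len (inv x) = d x \<one>" using d_eq_len[of x \<one>] assms one_H inv_H by (simp add: H_carrier)
  then show ?thesis using d_facts(3) assms one_H by (simp add: len_def)
qed

text \<open>Right multiplication by \<open>g\<close> moves a point \<open>k\<close> of \<open>K\<close> to \<open>h \<otimes> k'\<close>, a point of the translate of
  \<open>K\<close> by \<open>h\<close>. The supremum of the lengths of all \<open>h\<close> that occur is a substitute on \<open>G\<close> for the
  length on \<open>H\<close>; it need not be continuous. Its sublevel sets are used directly, since
  they are what the construction of a pseudometric consumes.\<close>

definition drift_le :: "real \<Rightarrow> 'a set" where
  "drift_le r = {g \<in> carrier G. \<forall>k\<in>K. \<forall>k'\<in>K. \<forall>h\<in>H. k \<otimes> g = h \<otimes> k' \<longrightarrow> len h \<le> r}"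

lemma drift_le_mono: "r \<le> s \<Longrightarrow> drift_le r \<subseteq> drift_le s"
  unfolding drift_le_def by fastforce

lemma drift_le_inv: assumes "g \<in> drift_le r" shows "inv g \<in> drift_le r"
proof -
  have g: "g \<in> carrier G" using assms by (simp add: drift_le_def)
  have "len h \<le> r" if kh: "k \<in> K" "k' \<in> K" "h \<in> H" "k \<otimes> inv g = h \<otimes> k'" for k k' h
  proof -
    note c = K_carrier[OF kh(1)] K_carrier[OF kh(2)] H_carrier[OF kh(3)] g
    have "inv h \<otimes> k = inv h \<otimes> (k \<otimes> inv g) \<otimes> g" using c by (simp add: m_assoc)
    also have "\<dots> = k' \<otimes> g" using c by (simp add: kh(4) inv_mult_cancel)
    finally have "len (inv h) \<le> r" using assms kh inv_H by (simp add: drift_le_def)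
    then show ?thesis using len_inv kh by simp
  qed
  then show ?thesis using g by (simp add: drift_le_def)
qed

text \<open>Follow \<open>k\<close> under \<open>a\<close> and then under \<open>b\<close>. As \<open>G = HK\<close>, the intermediate point can be written
  \<open>u \<otimes> q\<close> with \<open>q \<in> K\<close>. The drift along \<open>a\<close> is \<open>u\<close>, the drift along \<open>b\<close> from \<open>q\<close> is \<open>inv u \<otimes> h\<close>,
  and their product is \<open>h\<close>.\<close>

lemma drift_le_mult:
  assumes "a \<in> drift_le r" "b \<in> drift_le s" shows "a \<otimes> b \<in> drift_le (r + s)"
proof -
  have ab: "a \<in> carrier G" "b \<in> carrier G" using assms by (auto simp: drift_le_def)
  have "len h \<le> r + s" if kh: "k \<in> K" "k' \<in> K" "h \<in> H" "k \<otimes> (a \<otimes> b) = h \<otimes> k'" for k k' h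
  proof -
    note c = K_carrier[OF kh(1)] K_carrier[OF kh(2)] H_carrier[OF kh(3)] ab
    obtain u q where u: "u \<in> H" "q \<in> K" "k \<otimes> a = u \<otimes> q"
      using decompose[of "k \<otimes> a"] c by blast
    note c = c H_carrier[OF u(1)] K_carrier[OF u(2)]
    \<comment> \<open>hence \<open>q \<otimes> b = (inv u \<otimes> h) \<otimes> k'\<close> exhibits a drift of \<open>b\<close>\<close>
    have "q \<otimes> b = inv u \<otimes> ((k \<otimes> a) \<otimes> b)" using c by (simp add: u(3) m_assoc inv_mult_cancel)
    also have "\<dots> = inv u \<otimes> h \<otimes> k'" using c kh(4) by (simp add: m_assoc)
    finally have "len (inv u \<otimes> h) \<le> s" using assms(2) u kh inv_H mult_H by (simp add: drift_le_def)
    moreover have "len u \<le> r" using assms(1) u kh by (simp add: drift_le_def)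
    moreover have "len (u \<otimes> (inv u \<otimes> h)) \<le> len u + len (inv u \<otimes> h)"
      using u kh inv_H mult_H by (intro len_mult) auto
    ultimately show ?thesis using c by (simp add: inv_mult_cancel)
  qed
  then show ?thesis using ab by (simp add: drift_le_def)
qed

text \<open>The identity lies in \<open>HK\<close>, so \<open>K\<close> meets \<open>H\<close> in some \<open>k\<close>. Starting at \<open>k\<close>, an element \<open>h\<close> of \<open>H\<close>
  drifts by its conjugate \<open>k \<otimes> h \<otimes> inv k\<close>, whose length differs from that of \<open>h\<close> by at most twice
  the length of \<open>k\<close>.\<close>

lemma len_le_drift:
  obtains b where "\<And>h r. \<lbrakk>h \<in> H; h \<in> drift_le r\<rbrakk> \<Longrightarrow> len h \<le> r + b"
proof -
  obtain u k where uk: "u \<in> H" "k \<in> K" "\<one> = u \<otimes> k" using decompose[OF one_closed] by blast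
  then have "k = inv u" using inv_equality H_carrier K_carrier by (metis inv_comm inv_unique' inv_inv)
  then have k: "k \<in> H" using uk inv_H by simp
  have "len h \<le> r + (len k + len k)" if h: "h \<in> H" "h \<in> drift_le r" for h r
  proof -
    note c = H_carrier[OF k] H_carrier[OF h(1)]
    let ?x = "k \<otimes> h \<otimes> inv k"
    have x: "?x \<in> H" using k h mult_H inv_H by simp
    have "k \<otimes> h = ?x \<otimes> k" using c by (simp add: m_assoc)
    then have "len ?x \<le> r" using h(2) x uk(2) by (simp add: drift_le_def)
    moreover have "h = inv k \<otimes> (?x \<otimes> k)" using c by (simp add: m_assoc inv_mult_cancel)
    moreover have "len (inv k \<otimes> (?x \<otimes> k)) \<le> len (inv k) + (len ?x + len k)"
      using len_mult[of "inv k" "?x \<otimes> k"] len_mult[of ?x k] k x inv_H mult_H by fastforce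
    ultimately show ?thesis using len_inv[OF k] by simp
  qed
  then show ?thesis by (rule that)
qed

text \<open>This is where closedness of \<open>H\<close> enters: the set removed from \<open>G\<close> is closed in \<open>H\<close>, hence in \<open>G\<close>.\<close>

lemma openin_len_less: "openin T {x \<in> carrier G. x \<in> H \<longrightarrow> len x < r}"
proof -
  have top: "topspace (subtopology T H) = H" using H_carrier topspace_eq by auto
  have "continuous_map (subtopology T H) (prod_topology (subtopology T H) (subtopology T H)) (\<lambda>x. (\<one>, x))"
    using one_H top by (simp add: continuous_map_pairwise o_def del: topspace_subtopology)
  moreover have "continuous_map (prod_topology (subtopology T H) (subtopology T H)) euclideanreal (\<lambda>(x, y). d x y)"
    using d by (simp add: cont_left_inv_pseudometrics_def)
  ultimately have "continuous_map (subtopology T H) euclideanreal ((\<lambda>(x, y). d x y) \<circ> (\<lambda>x. (\<one>, x)))"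
    by (rule continuous_map_compose)
  then have "continuous_map (subtopology T H) euclideanreal len" by (simp add: o_def len_def[abs_def])
  then have "closedin (subtopology T H) {x \<in> topspace (subtopology T H). len x \<in> {r..}}"
    by (rule closedin_continuous_map_preimage) simp
  then have "closedin (subtopology T H) {x \<in> H. r \<le> len x}"
    unfolding top by simp
  then have "closedin T {x \<in> H. r \<le> len x}" using closedin_trans_full closed by blast
  then have "openin T (topspace T - {x \<in> H. r \<le> len x})" by blast
  moreover have "topspace T - {x \<in> H. r \<le> len x} = {x \<in> carrier G. x \<in> H \<longrightarrow> len x < r}"
    using topspace_eq by auto
  ultimately show ?thesis by simp
qed

text \<open>The drifts of \<open>g\<close> are the elements of \<open>H\<close> in the compact set \<open>K g K\<^bsup>-1\<^esup>\<close>. The open sets on which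
  elements of \<open>H\<close> have length below \<open>n\<close> increase to \<open>G\<close>, so one of them contains \<open>K g K\<^bsup>-1\<^esup>\<close>, and by the
  tube lemma also \<open>K x K\<^bsup>-1\<^esup>\<close> for all \<open>x\<close> near \<open>g\<close>.\<close>

lemma drift_locally_bounded:
  assumes g: "g \<in> carrier G"
  obtains U n where "openin T U" "g \<in> U" "U \<subseteq> drift_le (real n)"
proof -
  let ?O = "\<lambda>n::nat. {x \<in> carrier G. x \<in> H \<longrightarrow> len x < real n}"
  define m where "m p = fst (fst p) \<otimes> snd p \<otimes> inv (snd (fst p))" for p
  have mult: "continuous_map X T (\<lambda>p. a p \<otimes> b p)"
    if "continuous_map X T a" "continuous_map X T b" for X :: "(('a \<times> 'a) \<times> 'a) topology" and a b
  proof -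
    have "continuous_map X (prod_topology T T) (\<lambda>p. (a p, b p))"
      using that by (simp add: continuous_map_pairwise o_def)
    then have "continuous_map X T ((\<lambda>(x, y). x \<otimes> y) \<circ> (\<lambda>p. (a p, b p)))"
      using top_group unfolding topological_group_def by (intro continuous_map_compose) auto
    then show ?thesis by (simp add: o_def)
  qed
  let ?P = "prod_topology (prod_topology T T) T"
  have fst: "continuous_map ?P T (\<lambda>p. fst (fst p))" and "continuous_map ?P T (\<lambda>p. snd (fst p))"
    using continuous_map_compose[OF continuous_map_fst continuous_map_fst]
      continuous_map_compose[OF continuous_map_fst continuous_map_snd] by (simp_all add: o_def)
  then have "continuous_map ?P T ((\<lambda>x. inv x) \<circ> (\<lambda>p. snd (fst p)))"
    using top_group unfolding topological_group_def by (intro continuous_map_compose) auto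
  then have inv: "continuous_map ?P T (\<lambda>p. inv (snd (fst p)))" by (simp add: o_def)
  have m: "continuous_map ?P T m" unfolding m_def
    by (intro mult inv fst continuous_map_snd)
  have cK: "compactin (prod_topology T T) (K \<times> K)" using compact by (simp add: compactin_Times)
  have "compactin ?P ((K \<times> K) \<times> {g})"
    using cK g topspace_eq by (simp add: compactin_Times)
  then have cm: "compactin T (m ` ((K \<times> K) \<times> {g}))" using m by (rule image_compactin)
  have "openin T W" if "W \<in> range ?O" for W using that openin_len_less by blast
  moreover have "m ` ((K \<times> K) \<times> {g}) \<subseteq> \<Union> (range ?O)"
  proof
    fix x assume "x \<in> m ` ((K \<times> K) \<times> {g})"
    then have "x \<in> carrier G" using g K_carrier by (auto simp: m_def)
    moreover obtain n where "len x < real n" using reals_Archimedean2 by blast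
    ultimately show "x \<in> \<Union> (range ?O)" by auto
  qed
  ultimately obtain F where F: "finite F" "F \<subseteq> range ?O" "m ` ((K \<times> K) \<times> {g}) \<subseteq> \<Union> F"
    using compactinD[OF cm, of "range ?O"] by blast
  then obtain N where N: "finite N" "F = ?O ` N" using finite_subset_image[of F ?O UNIV] by auto
  define n where "n = Max (insert 0 N)"
  have "?O i \<subseteq> ?O n" if "i \<in> N" for i
  proof -
    have "i \<le> n" using that N(1) by (auto simp: n_def)
    then show ?thesis by (auto intro: less_le_trans)
  qed
  then have "m ` ((K \<times> K) \<times> {g}) \<subseteq> ?O n" using F(3) N(2) by blast
  moreover have "(K \<times> K) \<times> {g} \<subseteq> topspace ?P" using K_carrier g topspace_eq by auto
  ultimately have sub: "(K \<times> K) \<times> {g} \<subseteq> {p \<in> topspace ?P. m p \<in> ?O n}" by blast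
  have "openin ?P {p \<in> topspace ?P. m p \<in> ?O n}"
    by (rule openin_continuous_map_preimage[OF m openin_len_less])
  from tube_lemma_left[OF this cK _ sub] obtain A U where
    AU: "openin T U" "K \<times> K \<subseteq> A" "g \<in> U" "A \<times> U \<subseteq> {p \<in> topspace ?P. m p \<in> ?O n}"
    using g topspace_eq by auto
  have "U \<subseteq> drift_le (real n)"
  proof
    fix x assume x: "x \<in> U"
    then have xG: "x \<in> carrier G" using openin_subset[OF AU(1)] topspace_eq by blast
    have "len h \<le> real n" if kh: "k \<in> K" "k' \<in> K" "h \<in> H" "k \<otimes> x = h \<otimes> k'" for k k' h
    proof -
      have "((k, k'), x) \<in> A \<times> U" using kh AU(2) x by blast
      then have "m ((k, k'), x) \<in> ?O n" using AU(4) by blast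
      moreover have "m ((k, k'), x) = h"
        using kh K_carrier H_carrier by (simp add: m_def m_assoc)
      ultimately show ?thesis using kh(3) by simp
    qed
    then show "x \<in> drift_le (real n)" using xG by (simp add: drift_le_def)
  qed
  then show ?thesis using that AU by blast
qed

text \<open>Drift bounds add under multiplication, so bounds growing like \<open>3\<^sup>n\<close> give levels into whose
  successor triple products fall. Hence \<open>D x y < 2\<^sup>n\<close> bounds the drift of \<open>inv x \<otimes> y\<close>, and thereby
  \<open>d x y\<close>, in terms of \<open>n\<close> alone.\<close>

theorem dominating_pseudometric:
  obtains D B where "D \<in> cont_left_inv_pseudometrics G T"
    "\<And>x y n. \<lbrakk>x \<in> H; y \<in> H; D x y < 2 ^ n\<rbrakk> \<Longrightarrow> d x y \<le> B n"
proof -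
  obtain U n0 where U: "openin T U" "\<one> \<in> U" "U \<subseteq> drift_le (real n0)"
    using drift_locally_bounded[OF one_closed] by blast
  \<comment> \<open>adding one makes the bounds \<open>3\<^sup>n * c\<close> unbounded even if \<open>n0 = 0\<close>\<close>
  define c where "c = real n0 + 1"
  have c: "1 \<le> c" "real n0 \<le> c" by (auto simp: c_def)
  define V where "V n = drift_le (3 ^ n * c)" for n :: nat
  have Uc: "U \<subseteq> V 0" using U(3) drift_le_mono[OF c(2)] by (auto simp: V_def)
  have 1: "V n \<subseteq> carrier G" for n by (auto simp: V_def drift_le_def)
  have 2: "\<one> \<in> V n" for n
  proof -
    have "c \<le> 3 ^ n * c" using c mult_right_mono[of 1 "3 ^ n" c] by simp
    then show ?thesis using drift_le_mono Uc U(2) by (fastforce simp: V_def)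
  qed
  have 3: "inv x \<in> V n" if "x \<in> V n" for x n using drift_le_inv that by (simp add: V_def)
  have 4: "x \<otimes> y \<otimes> z \<in> V (Suc n)" if "x \<in> V n" "y \<in> V n" "z \<in> V n" for x y z n
  proof -
    have "x \<otimes> y \<otimes> z \<in> drift_le (3 ^ n * c + 3 ^ n * c + 3 ^ n * c)"
      using drift_le_mult that unfolding V_def by blast
    then show ?thesis by (simp add: V_def algebra_simps)
  qed
  have 5: "\<exists>n. x \<in> V n" if x: "x \<in> carrier G" for x
  proof -
    obtain n where "x \<in> drift_le (real n)" by (rule drift_locally_bounded[OF x]) blast
    moreover obtain i where "real n < 3 ^ i" using real_arch_pow[of 3 "real n"] by auto
    moreover have "(3::real) ^ i \<le> 3 ^ i * c" using c mult_left_mono[of 1 c "3 ^ i"] by simp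
    ultimately have "drift_le (real n) \<subseteq> V i" unfolding V_def by (intro drift_le_mono) linarith
    then have "x \<in> V i" using \<open>x \<in> drift_le (real n)\<close> by blast
    then show ?thesis ..
  qed
  obtain D where D: "D \<in> cont_left_inv_pseudometrics G T"
    "\<And>x y n. \<lbrakk>x \<in> carrier G; y \<in> carrier G; D x y < 2 ^ n\<rbrakk> \<Longrightarrow> inv x \<otimes> y \<in> V n"
    using filtration_pseudometric[OF top_group 1 2 3 4 5 U(1,2) Uc] by blast
  obtain b where b: "\<And>h r. \<lbrakk>h \<in> H; h \<in> drift_le r\<rbrakk> \<Longrightarrow> len h \<le> r + b"
    using len_le_drift by blast
  show ?thesis
  proof (rule that[OF D(1)])
    fix x y n assume xy: "x \<in> H" "y \<in> H" "D x y < 2 ^ n"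
    then have "inv x \<otimes> y \<in> drift_le (3 ^ n * c)" using D(2) H_carrier by (simp add: V_def)
    then show "d x y \<le> 3 ^ n * c + b" using b xy mult_H inv_H by (simp add: d_eq_len)
  qed
qed

end

section \<open>Coarse structure of a cocompact subgroup\<close>

lemma restrict_pseudometric:
  assumes "subgroup H G" "d \<in> cont_left_inv_pseudometrics G T"
  shows "d \<in> cont_left_inv_pseudometrics (G\<lparr>carrier := H\<rparr>) (subtopology T H)"
proof -
  have "H \<subseteq> carrier G" using assms(1) subgroup.subset by blast
  moreover have "continuous_map (prod_topology (subtopology T H) (subtopology T H)) euclideanreal (\<lambda>(x, y). d x y)"
    using assms(2) by (auto simp: cont_left_inv_pseudometrics_def prod_topology_subtopology
      intro!: continuous_map_from_subtopology)
  ultimately show ?thesis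
    using assms(2) by (auto simp: cont_left_inv_pseudometrics_def pseudometric_on_def subset_iff)
qed

text \<open>The heart of the theorem: \<open>H\<close> carries the coarse structure induced from \<open>G\<close>. Restricting
  pseudometrics gives one inclusion, and the dominating pseudometrics give the other.\<close>

lemma left_entourages_cocompact_subgroup:
  assumes G: "topological_group G T" and H: "subgroup H G" "closedin T H"
    and K: "compactin T K" "carrier G = H <#>\<^bsub>G\<^esub> K"
  shows "left_entourages (G\<lparr>carrier := H\<rparr>) (subtopology T H) = {E \<in> left_entourages G T. E \<subseteq> H \<times> H}"
    (is "?EH = ?EG")
proof (intro equalityI subsetI)
  fix E assume E: "E \<in> ?EH"
  have "H \<subseteq> carrier G" using H subgroup.subset by blast
  then show "E \<in> ?EG" using E restrict_pseudometric[OF H(1)] by (auto simp: left_entourages_def)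
next
  fix E assume E: "E \<in> ?EG"
  have "bdd_above ((\<lambda>(x, y). d x y) ` E)"
    if d: "d \<in> cont_left_inv_pseudometrics (G\<lparr>carrier := H\<rparr>) (subtopology T H)" for d
  proof -
    interpret cocompact_pseudometric G T H K d
      using G H K d by (simp add: cocompact_pseudometric_def cocompact_pseudometric_axioms_def topological_group_def)
    obtain D B where D: "D \<in> cont_left_inv_pseudometrics G T"
      and B: "\<And>x y n. \<lbrakk>x \<in> H; y \<in> H; D x y < 2 ^ n\<rbrakk> \<Longrightarrow> d x y \<le> B n"
      using dominating_pseudometric by blast
    obtain r where r: "\<And>x y. (x, y) \<in> E \<Longrightarrow> D x y \<le> r"
      using E D unfolding left_entourages_def bdd_above_def by fast
    obtain n where "r < 2 ^ n" using real_arch_pow[of 2 r] by auto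
    then have "d x y \<le> B n" if "(x, y) \<in> E" for x y using r[OF that] B E that by fastforce
    then show ?thesis by (intro bdd_aboveI[of _ "B n"]) auto
  qed
  then show "E \<in> ?EH" using E by (auto simp: left_entourages_def)
qed

lemma left_entouragesI:
  assumes "E \<subseteq> carrier G \<times> carrier G"
    and "\<And>d. d \<in> cont_left_inv_pseudometrics G T \<Longrightarrow> \<exists>r. \<forall>(x, y)\<in>E. d x y \<le> r"
  shows "E \<in> left_entourages G T"
  using assms unfolding left_entourages_def bdd_above_def by fast

lemma left_entouragesD:
  assumes "E \<in> left_entourages G T" "d \<in> cont_left_inv_pseudometrics G T"
  obtains r where "\<And>x y. (x, y) \<in> E \<Longrightarrow> d x y \<le> r"
  using assms unfolding left_entourages_def bdd_above_def by fast

lemma displacement_of_compact_bounded: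
  assumes G: "topological_group G T" and K: "compactin T K"
    and d: "d \<in> cont_left_inv_pseudometrics G T"
  obtains r where "\<And>g k. \<lbrakk>g \<in> carrier G; k \<in> K\<rbrakk> \<Longrightarrow> d g (g \<otimes>\<^bsub>G\<^esub> k) \<le> r"
proof -
  interpret group G using G by (simp add: topological_group_def)
  have top: "topspace T = carrier G" using G by (simp add: topological_group_def)
  have "continuous_map T (prod_topology T T) (\<lambda>x. (\<one>\<^bsub>G\<^esub>, x))"
    using top by (simp add: continuous_map_pairwise o_def)
  moreover have "continuous_map (prod_topology T T) euclideanreal (\<lambda>(x, y). d x y)"
    using d by (simp add: cont_left_inv_pseudometrics_def)
  ultimately have "continuous_map T euclideanreal ((\<lambda>(x, y). d x y) \<circ> (\<lambda>x. (\<one>\<^bsub>G\<^esub>, x)))"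
    by (rule continuous_map_compose)
  then have "compactin euclideanreal (d \<one>\<^bsub>G\<^esub> ` K)" using image_compactin[OF K, of euclideanreal "d \<one>\<^bsub>G\<^esub>"] by (simp add: o_def)
  then have "bdd_above (d \<one>\<^bsub>G\<^esub> ` K)"
    by (simp add: compact_imp_bounded bounded_imp_bdd_above)
  then obtain r where r: "\<And>k. k \<in> K \<Longrightarrow> d \<one>\<^bsub>G\<^esub> k \<le> r" by (auto simp: bdd_above_def)
  have "d g (g \<otimes>\<^bsub>G\<^esub> k) \<le> r" if g: "g \<in> carrier G" and k: "k \<in> K" for g k
  proof -
    have kG: "k \<in> carrier G" using k compactin_subset_topspace[OF K] top by blast
    have "d (g \<otimes>\<^bsub>G\<^esub> \<one>\<^bsub>G\<^esub>) (g \<otimes>\<^bsub>G\<^esub> k) = d \<one>\<^bsub>G\<^esub> k"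
      using d g kG unfolding cont_left_inv_pseudometrics_def by blast
    then show ?thesis using r[OF k] g by simp
  qed
  then show ?thesis by (rule that)
qed

text \<open>A map that moves points by a bounded amount changes distances by a bounded amount, so it
  neither creates nor destroys entourages.\<close>

lemma left_entourages_near_map:
  assumes E: "E \<in> left_entourages G T" and f: "f \<in> carrier G \<rightarrow> carrier G"
    and near: "\<forall>d\<in>cont_left_inv_pseudometrics G T. \<exists>r. \<forall>g\<in>carrier G. d (f g) g \<le> r"
  shows "map_prod f f ` E \<in> left_entourages G T"
    "E' \<subseteq> carrier G \<times> carrier G \<Longrightarrow> map_prod f f ` E' \<subseteq> E \<Longrightarrow> E' \<in> left_entourages G T"
proof -
  have EG: "E \<subseteq> carrier G \<times> carrier G" using E by (simp add: left_entourages_def)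
  have *: "\<exists>r. \<forall>x\<in>carrier G. \<forall>y\<in>carrier G. \<bar>d (f x) (f y) - d x y\<bar> \<le> r"
    if d: "d \<in> cont_left_inv_pseudometrics G T" for d
  proof -
    obtain r where r: "\<And>g. g \<in> carrier G \<Longrightarrow> d (f g) g \<le> r" using near d by blast
    have P: "pseudometric_on (carrier G) d" using d by (simp add: cont_left_inv_pseudometrics_def)
    have "\<bar>d (f x) (f y) - d x y\<bar> \<le> r + r" if xy: "x \<in> carrier G" "y \<in> carrier G" for x y
    proof -
      have fxy: "f x \<in> carrier G" "f y \<in> carrier G" using f xy by auto
      have "d (f x) (f y) \<le> d (f x) x + d x (f y)" "d x (f y) \<le> d x y + d y (f y)"
        "d x y \<le> d x (f x) + d (f x) y" "d (f x) y \<le> d (f x) (f y) + d (f y) y"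
        "d x (f x) = d (f x) x" "d y (f y) = d (f y) y"
        using P xy fxy unfolding pseudometric_on_def by blast+
      then show ?thesis using r[OF xy(1)] r[OF xy(2)] by linarith
    qed
    then show ?thesis by blast
  qed
  show "map_prod f f ` E \<in> left_entourages G T"
  proof (rule left_entouragesI)
    show "map_prod f f ` E \<subseteq> carrier G \<times> carrier G" using EG f by auto
    fix d assume d: "d \<in> cont_left_inv_pseudometrics G T"
    obtain r where r: "\<forall>x\<in>carrier G. \<forall>y\<in>carrier G. \<bar>d (f x) (f y) - d x y\<bar> \<le> r" using *[OF d] by blast
    obtain s where s: "\<And>x y. (x, y) \<in> E \<Longrightarrow> d x y \<le> s" using left_entouragesD[OF E d] by blast
    have "d (f x) (f y) \<le> r + s" if "(x, y) \<in> E" for x y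
    proof -
      have "\<bar>d (f x) (f y) - d x y\<bar> \<le> r" using r EG that by blast
      then show ?thesis using s[OF that] by linarith
    qed
    then show "\<exists>r. \<forall>(x, y)\<in>map_prod f f ` E. d x y \<le> r" by fastforce
  qed
  assume E': "E' \<subseteq> carrier G \<times> carrier G" "map_prod f f ` E' \<subseteq> E"
  show "E' \<in> left_entourages G T"
  proof (rule left_entouragesI[OF E'(1)])
    fix d assume d: "d \<in> cont_left_inv_pseudometrics G T"
    obtain r where r: "\<forall>x\<in>carrier G. \<forall>y\<in>carrier G. \<bar>d (f x) (f y) - d x y\<bar> \<le> r" using *[OF d] by blast
    obtain s where s: "\<And>x y. (x, y) \<in> E \<Longrightarrow> d x y \<le> s" using left_entouragesD[OF E d] by blast
    have "d x y \<le> r + s" if "(x, y) \<in> E'" for x y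
    proof -
      have "\<bar>d (f x) (f y) - d x y\<bar> \<le> r" using r E' that by blast
      moreover have "(f x, f y) \<in> E" using E' that by auto
      ultimately show ?thesis using s[of "f x" "f y"] by linarith
    qed
    then show "\<exists>r. \<forall>(x, y)\<in>E'. d x y \<le> r" by fastforce
  qed
qed

text \<open>A quasi-inverse sends \<open>g = h \<otimes> k\<close> to \<open>h\<close>, for an arbitrary choice of the decomposition. It moves
  points by a bounded amount, because \<open>d h (h \<otimes> k) = d 1 k\<close> is bounded for \<open>k\<close> in the compact set
  \<open>K\<close>.\<close>

theorem inclusion_coarse_equivalence:
  assumes G: "topological_group G T" and H: "subgroup H G" "closedin T H"
    and "cocompact G T H"
  shows "coarse_equivalence H (left_entourages (G\<lparr>carrier := H\<rparr>) (subtopology T H))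
    (carrier G) (left_entourages G T) (\<lambda>h. h)"
proof -
  interpret group G using G by (simp add: topological_group_def)
  obtain K where K: "compactin T K" "carrier G = H <#>\<^bsub>G\<^esub> K"
    using \<open>cocompact G T H\<close> by (auto simp: cocompact_def)
  let ?EG = "left_entourages G T"
  define EH where "EH = left_entourages (G\<lparr>carrier := H\<rparr>) (subtopology T H)"
  have EH: "EH = {E \<in> ?EG. E \<subseteq> H \<times> H}"
    unfolding EH_def by (rule left_entourages_cocompact_subgroup[OF G H K])
  have HG: "H \<subseteq> carrier G" using H subgroup.subset by blast
  have KG: "K \<subseteq> carrier G" using compactin_subset_topspace[OF K(1)] G by (simp add: topological_group_def)
  have mono: "E \<in> ?EG" if "E \<subseteq> E'" "E' \<in> ?EG" for E E'
  proof -
    have "bdd_above ((\<lambda>(x, y). d x y) ` E)" if "bdd_above ((\<lambda>(x, y). d x y) ` E')" for d :: "'a \<Rightarrow> 'a \<Rightarrow> real"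
      by (rule bdd_above_mono[OF that image_mono[OF \<open>E \<subseteq> E'\<close>]])
    then show ?thesis using that by (auto simp: left_entourages_def)
  qed
  have "\<forall>g\<in>carrier G. \<exists>h. h \<in> H \<and> (\<exists>k\<in>K. g = h \<otimes>\<^bsub>G\<^esub> k)"
    using K(2) by (auto simp: set_mult_def)
  then obtain \<psi> where \<psi>: "\<And>g. g \<in> carrier G \<Longrightarrow> \<psi> g \<in> H"
    "\<And>g. g \<in> carrier G \<Longrightarrow> \<exists>k\<in>K. g = \<psi> g \<otimes>\<^bsub>G\<^esub> k" by metis
  have \<psi>G: "\<psi> \<in> carrier G \<rightarrow> carrier G" using \<psi>(1) HG by blast
  have near: "\<forall>d\<in>cont_left_inv_pseudometrics G T. \<exists>r. \<forall>g\<in>carrier G. d (\<psi> g) g \<le> r"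
  proof
    fix d assume d: "d \<in> cont_left_inv_pseudometrics G T"
    obtain r where "\<And>g k. \<lbrakk>g \<in> carrier G; k \<in> K\<rbrakk> \<Longrightarrow> d g (g \<otimes>\<^bsub>G\<^esub> k) \<le> r"
      using displacement_of_compact_bounded[OF G K(1) d] by blast
    then have "d (\<psi> g) g \<le> r" if "g \<in> carrier G" for g using \<psi> HG that by (metis subsetD)
    then show "\<exists>r. \<forall>g\<in>carrier G. d (\<psi> g) g \<le> r" by blast
  qed
  have close: "(\<lambda>g. (\<psi> g, g)) ` carrier G \<in> ?EG"
    using \<psi>G near by (intro left_entouragesI) auto
  have "coarse_map H EH (carrier G) ?EG (\<lambda>h. h)"
    unfolding coarse_map_def
  proof (intro conjI)
    show "controlled EH ?EG (\<lambda>h. h)" by (simp add: controlled_def EH map_prod.id[unfolded id_def])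
    show "coarsely_proper H EH (carrier G) ?EG (\<lambda>h. h)"
      unfolding coarsely_proper_def coarsely_bounded_def EH
    proof (intro allI impI conjI)
      fix B assume "B \<subseteq> carrier G \<and> B \<times> B \<in> ?EG"
      then have "{x \<in> H. x \<in> B} \<times> {x \<in> H. x \<in> B} \<in> ?EG" by (elim conjE) (rule mono[of _ "B \<times> B"]; auto)
      then show "{x \<in> H. x \<in> B} \<times> {x \<in> H. x \<in> B} \<in> {E \<in> ?EG. E \<subseteq> H \<times> H}" by auto
    qed auto
  qed (use HG in auto)
  moreover have "coarse_map (carrier G) ?EG H EH \<psi>"
    unfolding coarse_map_def
  proof (intro conjI)
    show "controlled ?EG EH \<psi>"
      unfolding controlled_def
    proof
      fix E assume E: "E \<in> ?EG"
      then have "map_prod \<psi> \<psi> ` E \<subseteq> H \<times> H" using \<psi>(1) by (auto simp: left_entourages_def)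
      moreover have "map_prod \<psi> \<psi> ` E \<in> ?EG" by (rule left_entourages_near_map(1)[OF E \<psi>G near])
      ultimately show "map_prod \<psi> \<psi> ` E \<in> EH" by (simp add: EH)
    qed
    show "coarsely_proper (carrier G) ?EG H EH \<psi>"
      unfolding coarsely_proper_def coarsely_bounded_def
    proof (intro allI impI conjI)
      fix B assume "B \<subseteq> H \<and> B \<times> B \<in> EH"
      then have B: "B \<times> B \<in> ?EG" by (simp add: EH)
      show "{x \<in> carrier G. \<psi> x \<in> B} \<times> {x \<in> carrier G. \<psi> x \<in> B} \<in> ?EG"
        by (rule left_entourages_near_map(2)[OF B \<psi>G near]) auto
    qed auto
  qed (use \<psi>(1) in auto)
  moreover have "close_maps (carrier G) ?EG ((\<lambda>h. h) \<circ> \<psi>) id"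
    using close by (simp add: close_maps_def)
  moreover have "close_maps H EH (\<psi> \<circ> (\<lambda>h. h)) id"
  proof -
    have "(\<lambda>g. (\<psi> g, g)) ` H \<in> ?EG" using HG by (rule mono[OF image_mono close])
    then show ?thesis using \<psi>(1) HG by (auto simp: close_maps_def EH)
  qed
  ultimately show ?thesis unfolding coarse_equivalence_def EH_def by blast
qed

theorem theorem7p4:
  fixes G :: "('a, 'b) monoid_scheme" and T :: "'a topology" and H :: "'a set"
  assumes "polish_group G T"
    and "subgroup H G"
    and "closedin T H"
    and "cocompact G T H"
  shows "coarsely_equivalent
           H (left_entourages (G\<lparr>carrier := H\<rparr>) (subtopology T H))
           (carrier G) (left_entourages G T)
       \<and> coarse_equivalence
           H (left_entourages (G\<lparr>carrier := H\<rparr>) (subtopology T H))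
           (carrier G) (left_entourages G T) (\<lambda>h. h)"
  using inclusion_coarse_equivalence[OF _ assms(2-4)] assms(1)
  unfolding coarsely_equivalent_def polish_group_def by blast

end
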